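(* Let $\mathcal{T}\in\mathbb{R}^{I\times J\times K}$ and $R\ge1$. Let $(\mathbf{B}_n,\mathbf{C}_n)_n$, with $\mathbf{B}_n\in\mathbb{R}^{J\times R}$, $\mathbf{C}_n\in\mathbb{R}^{K\times R}$, be a minimizing sequence of $\mathfrak{J}_{red}$ (and thus $(\tilde{\mathbf{A}}[\mathbf{B}_n,\mathbf{C}_n],\mathbf{B}_n,\mathbf{C}_n)_n$ a minimizing sequence of $\mathfrak{J}$). Without loss of generality, we can assume that there exist matrices $\tilde{\mathbf{B}}$ and $\tilde{\mathbf{C}}$ with $$\lim_{n\to\infty}\mathbf{B}_n=\tilde{\mathbf{B}}\quad\text{and}\quad\lim_{n\to\infty}\mathbf{C}_n=\tilde{\mathbf{C}}.$$ If the rank condition $$\liminf_{n\to\infty}\mathrm{rank}(\mathbf{B}_n\odot\mathbf{C}_n)\le\mathrm{rank}(\tilde{\mathbf{B}}\odot\tilde{\mathbf{C}})$$ holds, then $(\tilde{\mathbf{B}},\tilde{\mathbf{C}})$ is a minimizer of $\mathfrak{J}_{red}$ and $(\tilde{\mathbf{A}}[\tilde{\mathbf{B}},\tilde{\mathbf{C}}],\tilde{\mathbf{B}},\tilde{\mathbf{C}})$ is a minimizer of $\mathfrak{J}$. In particular, a solution to the least squares problem $\min_{\mathbf{A},\mathbf{B},\mathbf{C}}\mathfrak{J}(\mathbf{A},\mathbf{B},\mathbf{C})$ exists.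
   Context: $I,J,K,R$ are positive integers. For $\mathbf{A}\in\mathbb{R}^{I\times R}$, $\mathbf{B}\in\mathbb{R}^{J\times R}$, $\mathbf{C}\in\mathbb{R}^{K\times R}$ with entries $a_{ir},b_{jr},c_{kr}$, $$\mathfrak{J}(\mathbf{A},\mathbf{B},\mathbf{C})=\tfrac12\sum_{i,j,k}\Big(\mathcal{T}_{ijk}-\sum_{r=1}^R a_{ir}b_{jr}c_{kr}\Big)^2 .$$ For fixed $\mathbf{B},\mathbf{C}$, $\tilde{\mathbf{A}}[\mathbf{B},\mathbf{C}]$ denotes a minimizer of $\mathbf{A}\mapsto\mathfrak{J}(\mathbf{A},\mathbf{B},\mathbf{C})$ over $\mathbb{R}^{I\times R}$ (it exists, being a solution of a finite-dimensional linear least-squares problem), and $\mathfrak{J}_{red}(\mathbf{B},\mathbf{C})=\mathfrak{J}(\tilde{\mathbf{A}}[\mathbf{B},\mathbf{C}],\mathbf{B},\mathbf{C})$, which does not depend on the choice of minimizer. The Khatri-Rao product $\mathbf{B}\odot\mathbf{C}\in\mathbb{R}^{JK\times R}$ is the matrix with columns $\mathbf{b}_r\otimes\mathbf{c}_r$ (Kronecker products of the corresponding columns of $\mathbf{B}$ and $\mathbf{C}$). A minimizing sequence is a sequence along which the functional converges to its infimum. "Without loss of generality" means that an arbitrary minimizing sequence of $\mathfrak{J}_{red}$ can be replaced, by normalizing the matrices and passing to a subsequence, by a convergent sequence that is again minimizing for $\mathfrak{J}_{red}$. *)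

theory Defs
  imports "HOL-Analysis.Analysis"
begin

text \<open>The positive integers \<open>I\<close>, \<open>J\<close>, \<open>K\<close>, \<open>R\<close> are the cardinalities of the finite index types
  \<open>'i\<close>, \<open>'j\<close>, \<open>'k\<close>, \<open>'r\<close>; an \<open>I \<times> R\<close> matrix has type \<open>real^'r^'i\<close>.\<close>

definition cp_obj ::
  "real^'k^'j^'i \<Rightarrow> real^'r^'i \<Rightarrow> real^'r^'j \<Rightarrow> real^'r^'k \<Rightarrow> real" where
  "cp_obj T A B C =
     1/2 * (\<Sum>i\<in>UNIV. \<Sum>j\<in>UNIV. \<Sum>k\<in>UNIV.
       (T $ i $ j $ k - (\<Sum>r\<in>UNIV. A $ i $ r * B $ j $ r * C $ k $ r))^2)"

abbreviation is_minimizer :: "('a \<Rightarrow> real) \<Rightarrow> 'a \<Rightarrow> bool" where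
  "is_minimizer f x \<equiv> is_arg_min f (\<lambda>_. True) x"

text \<open>Used only for functionals that are bounded below, so that the real-valued \<open>INF\<close> is the
  actual infimum.\<close>

definition minimizing_seq :: "('a \<Rightarrow> real) \<Rightarrow> (nat \<Rightarrow> 'a) \<Rightarrow> bool" where
  "minimizing_seq f X \<longleftrightarrow> (\<lambda>n. f (X n)) \<longlonglongrightarrow> (INF x. f x)"

text \<open>A fixed choice of the minimizer; \<open>cp_opt_A_minimizer\<close> and \<open>cp_red_eq\<close> below show that
  it exists and that the reduced functional does not depend on the choice.\<close>

definition cp_opt_A :: "real^'k^'j^'i \<Rightarrow> real^'r^'j \<Rightarrow> real^'r^'k \<Rightarrow> real^'r^'i" where
  "cp_opt_A T B C = (SOME A. is_minimizer (\<lambda>A. cp_obj T A B C) A)"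

definition cp_red :: "real^'k^'j^'i \<Rightarrow> real^'r^'j \<Rightarrow> real^'r^'k \<Rightarrow> real" where
  "cp_red T B C = cp_obj T (cp_opt_A T B C) B C"

definition kronecker_vec :: "real^'j \<Rightarrow> real^'k \<Rightarrow> real^('j \<times> 'k)" where
  "kronecker_vec b c = (\<chi> p. b $ fst p * c $ snd p)"

definition khatri_rao :: "real^'r^'j \<Rightarrow> real^'r^'k \<Rightarrow> real^'r^('j \<times> 'k)" where
  "khatri_rao B C = (\<chi> p r. kronecker_vec (column r B) (column r C) $ p)"

text \<open>Zero columns stay zero, since \<open>0 / 0 = 0\<close>.\<close>

definition normalize_columns :: "real^'r^'m \<Rightarrow> real^'r^'m" where
  "normalize_columns M = (\<chi> m r. M $ m $ r / norm (column r M))"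

lemma cp_obj_norm:
  fixes T :: "real^'k^'j^'i"
  shows "cp_obj T A B C =
     1/2 * (dist T (\<chi> i j k. \<Sum>r\<in>UNIV. A $ i $ r * B $ j $ r * C $ k $ r))^2"
proof -
  have "(norm x)\<^sup>2 = (\<Sum>i\<in>UNIV. \<Sum>j\<in>UNIV. \<Sum>k\<in>UNIV. (x $ i $ j $ k)\<^sup>2)" for x :: "real^'k^'j^'i"
    unfolding power2_norm_eq_inner inner_vec_def by (simp add: power2_eq_square)
  then show ?thesis
    by (simp add: cp_obj_def dist_norm)
qed

lemma cp_obj_minimizer_exists: "\<exists>A. is_minimizer (\<lambda>A. cp_obj T A B C) A"
proof -
  let ?L = "\<lambda>A. (\<chi> i j k. \<Sum>r\<in>UNIV. A $ i $ r * B $ j $ r * C $ k $ r)"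
  have lin: "linear ?L"
    by (rule linearI)
      (simp_all add: vec_eq_iff distrib_right sum.distrib sum_distrib_left mult.assoc)
  then have "closed (range ?L)"
    using closed_subspace[OF linear_subspace_image[OF lin subspace_UNIV]] by blast
  then obtain y where "y \<in> range ?L" and y: "\<forall>z\<in>range ?L. dist T y \<le> dist T z"
    by (rule distance_attains_inf[where a = T]) auto
  then obtain A where A: "y = ?L A" by blast
  have "cp_obj T A B C \<le> cp_obj T A' B C" for A'
    using y[unfolded A, rule_format, OF rangeI, of A']
    by (simp only: cp_obj_norm power_mono mult_left_mono zero_le_dist zero_le_numeral
        zero_le_divide_1_iff)
  then have "is_minimizer (\<lambda>A. cp_obj T A B C) A"
    by (simp add: is_arg_min_def not_less)
  then show ?thesis ..
qed

lemma cp_opt_A_minimizer: "is_minimizer (\<lambda>A. cp_obj T A B C) (cp_opt_A T B C)"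
  unfolding cp_opt_A_def by (rule someI_ex) (rule cp_obj_minimizer_exists)

lemma cp_red_eq: "is_minimizer (\<lambda>A. cp_obj T A B C) A \<Longrightarrow> cp_red T B C = cp_obj T A B C"
  using cp_opt_A_minimizer[of T B C]
  by (auto simp: is_arg_min_def cp_red_def not_less intro: antisym)

end

theory Submission
  imports Defs
begin

text \<open>
  For fixed \<open>B\<close>, \<open>C\<close> the functional is a sum over \<open>i\<close> of squared distances between the
  \<open>i\<close>-th slice of \<open>T\<close> and \<open>M *v a\<^sub>i\<close>, where \<open>M\<close> is the Khatri-Rao product of \<open>B\<close> and \<open>C\<close> and
  \<open>a\<^sub>i\<close> is the \<open>i\<close>-th row of \<open>A\<close> (\<open>cp_obj_khatri_rao\<close>). The functional is jointly continuous, so the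
  limit of a convergent minimizing sequence \<open>(B\<^sub>n, C\<^sub>n)\<close> is a minimizer as soon as the optimal \<open>A\<^sub>n\<close>
  can be chosen bounded along a subsequence.

  The rank condition provides this. It gives a subsequence with \<open>rank M\<^sub>n \<le> rank M\<close>, where \<open>M\<close> is
  the Khatri-Rao product of the limits. Let \<open>V\<close> be the row space of \<open>M\<close>. Since \<open>M\<close> is injective on
  \<open>V\<close>, it satisfies \<open>e * norm x \<le> norm (M *v x)\<close> there for some \<open>e > 0\<close>, and for large \<open>n\<close> the
  matrix \<open>M\<^sub>n\<close> satisfies the same bound with \<open>e / 2\<close> (\<open>rowspace_bounded_below\<close>). In particular
  \<open>M\<^sub>n\<close> is injective on \<open>V\<close>, so the image of \<open>V\<close> has dimension \<open>rank M \<ge> rank M\<^sub>n\<close> and is the whole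
  range of \<open>M\<^sub>n\<close> (\<open>image_rowspace_eq_range\<close>). Hence the rows of an optimal \<open>A\<^sub>n\<close> can be moved
  into \<open>V\<close> without changing the value, and there the lower bound controls them by their images
  under \<open>M\<^sub>n\<close>, which are bounded because \<open>A\<^sub>n\<close> does at least as well as \<open>0\<close>. Passing to a convergent
  subsequence of the \<open>A\<^sub>n\<close> proves \<open>cp_red_limit_le\<close>.

  The normalization statements hold because column scalings of \<open>B\<close> and \<open>C\<close> can be
  absorbed into \<open>A\<close> (\<open>cp_red_le_of_scaled_columns\<close>) and normalized matrices are bounded.
\<close>

section \<open>Infima and subsequences\<close>

lemma is_minimizer_iff: "is_minimizer f x \<longleftrightarrow> (\<forall>y. f x \<le> f y)"
  by (auto simp: is_arg_min_def not_less)

lemma minimizing_seq_dominated: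
  fixes f :: "'a \<Rightarrow> real"
  assumes "minimizing_seq f X" "bdd_below (range f)" "\<And>n. f (Y n) \<le> f (X n)"
  shows "minimizing_seq f Y"
  unfolding minimizing_seq_def
proof (rule tendsto_sandwich[OF _ _ tendsto_const])
  show "\<forall>\<^sub>F n in sequentially. (INF x. f x) \<le> f (Y n)"
    using assms(2) by (simp add: cINF_lower)
  show "\<forall>\<^sub>F n in sequentially. f (Y n) \<le> f (X n)"
    using assms(3) by simp
  show "(\<lambda>n. f (X n)) \<longlonglongrightarrow> (INF x. f x)"
    using assms(1) by (simp add: minimizing_seq_def)
qed

lemma minimizing_seq_subseq:
  fixes f :: "'a \<Rightarrow> real"
  assumes "minimizing_seq f X" "strict_mono \<phi>"
  shows "minimizing_seq f (X \<circ> \<phi>)"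
  using LIMSEQ_subseq_LIMSEQ[OF assms[unfolded minimizing_seq_def]]
  by (simp add: minimizing_seq_def comp_def)

lemma liminf_enat_le_imp_subseq:
  fixes g :: "nat \<Rightarrow> nat"
  assumes "liminf (\<lambda>n. enat (g n)) \<le> enat m"
  obtains \<phi> :: "nat \<Rightarrow> nat" where "strict_mono \<phi>" "\<And>n. g (\<phi> n) \<le> m"
proof -
  have "infinite {n. g n \<le> m}"
  proof
    assume "finite {n. g n \<le> m}"
    then have "\<forall>\<^sub>F n in sequentially. \<not> g n \<le> m"
      by (simp add: eventually_cofinite flip: cofinite_eq_sequentially)
    then have "\<forall>\<^sub>F n in sequentially. enat (Suc m) \<le> enat (g n)"
      by (rule eventually_mono) auto
    then have "enat (Suc m) \<le> liminf (\<lambda>n. enat (g n))"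
      by (rule Liminf_bounded)
    with assms have "enat (Suc m) \<le> enat m"
      by (rule order_trans[rotated])
    then show False by simp
  qed
  then show thesis
    using infinite_enumerate that by blast
qed

section \<open>Matrices of bounded rank near a given matrix\<close>

lemma bounded_bilinear_matrix_vector_mult:
  "bounded_bilinear (\<lambda>(M :: real^'n^'m) x. M *v x)"
  unfolding bilinear_conv_bounded_bilinear[symmetric] bilinear_def
  by (auto intro!: linearI
      simp: algebra_simps scaleR_matrix_vector_assoc)

text \<open>The row space is a complement of the kernel, so the limit matrix is injective on it; the
  resulting lower bound is stable under small perturbations.\<close>

lemma rowspace_bounded_below:
  fixes M :: "real^'n^'m"
  assumes "X \<longlonglongrightarrow> M"
  obtains c where "c > 0"
    "\<forall>\<^sub>F n in sequentially. \<forall>x\<in>span (rows M). c * norm x \<le> norm (X n *v x)"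
proof -
  have "\<exists>e>0. \<forall>x\<in>span (rows M). norm (M *v x) \<ge> e * norm x"
  proof (rule injective_imp_isometric)
    show "\<forall>x\<in>span (rows M). M *v x = 0 \<longrightarrow> x = 0"
      by (metis matrix_vector_mul_injective_on_rowspace matrix_vector_mult_0_right span_zero)
  qed simp_all
  then obtain e where "e > 0" and e: "\<And>x. x \<in> span (rows M) \<Longrightarrow> e * norm x \<le> norm (M *v x)"
    by blast
  obtain K where "K > 0"
    and K: "\<And>(N :: real^'n^'m) x. norm (N *v x) \<le> norm N * norm x * K"
    using bounded_bilinear.pos_bounded[OF bounded_bilinear_matrix_vector_mult] by blast
  have "\<forall>\<^sub>F n in sequentially. dist (X n) M < e / (2 * K)"
    using assms \<open>e > 0\<close> \<open>K > 0\<close> by (intro tendstoD) auto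
  then have "\<forall>\<^sub>F n in sequentially. \<forall>x\<in>span (rows M). e / 2 * norm x \<le> norm (X n *v x)"
  proof (rule eventually_mono, intro ballI)
    fix n x assume n: "dist (X n) M < e / (2 * K)" and x: "x \<in> span (rows M)"
    have "norm ((M - X n) *v x) \<le> norm (M - X n) * norm x * K"
      by (rule K)
    also have "\<dots> \<le> e / (2 * K) * norm x * K"
      using n \<open>K > 0\<close> by (intro mult_right_mono) (auto simp: dist_norm norm_minus_commute)
    also have "\<dots> = e / 2 * norm x"
      using \<open>K > 0\<close> by simp
    finally have "norm (M *v x - X n *v x) \<le> e / 2 * norm x"
      by (simp add: matrix_vector_mult_diff_rdistrib)
    then show "e / 2 * norm x \<le> norm (X n *v x)"
      using e[OF x] norm_triangle_ineq2[of "M *v x" "X n *v x"] by (simp add: field_simps)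
  qed
  with \<open>e > 0\<close> show thesis
    by (intro that[of "e / 2"]) auto
qed

lemma image_rowspace_eq_range:
  fixes M N :: "real^'n^'m"
  assumes rank: "rank N \<le> rank M"
    and inj: "\<And>x. x \<in> span (rows M) \<Longrightarrow> N *v x = 0 \<Longrightarrow> x = 0"
  shows "(*v) N ` span (rows M) = range ((*v) N)"
proof (rule subspace_dim_equal)
  have "inj_on ((*v) N) (span (rows M))"
    by (rule inj_onI) (metis inj eq_iff_diff_eq_0 matrix_vector_mult_diff_distrib span_diff)
  then have "dim ((*v) N ` span (rows M)) = dim (span (rows M))"
    by (intro dim_image_eq) (simp_all add: span_span)
  then show "dim (range ((*v) N)) \<le> dim ((*v) N ` span (rows M))"
    using rank by (simp add: rank_dim_range[symmetric] row_rank_def)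
qed (auto intro!: linear_subspace_image matrix_vector_mul_linear)

section \<open>The functional as a family of linear least-squares problems\<close>

text \<open>The \<open>i\<close>-th horizontal slice of a tensor, flattened to a vector.\<close>

definition tensor_slice :: "real^'k^'j^'i \<Rightarrow> 'i \<Rightarrow> real^('j \<times> 'k)" where
  "tensor_slice T i = (\<chi> p. T $ i $ fst p $ snd p)"

lemma khatri_rao_nth: "khatri_rao B C $ p $ r = B $ fst p $ r * C $ snd p $ r"
  by (simp add: khatri_rao_def kronecker_vec_def column_def)

text \<open>The rows of \<open>A\<close> decouple, and \<open>B\<close>, \<open>C\<close> enter only through their Khatri-Rao product.\<close>

lemma cp_obj_khatri_rao:
  "cp_obj T A B C = 1/2 * (\<Sum>i\<in>UNIV. (norm (tensor_slice T i - khatri_rao B C *v A $ i))\<^sup>2)"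
proof -
  have "(norm (tensor_slice T i - khatri_rao B C *v A $ i))\<^sup>2 =
    (\<Sum>j\<in>UNIV. \<Sum>k\<in>UNIV. (T $ i $ j $ k - (\<Sum>r\<in>UNIV. A $ i $ r * B $ j $ r * C $ k $ r))\<^sup>2)" for i
    unfolding power2_norm_eq_inner inner_vec_def
    by (simp add: tensor_slice_def matrix_vector_mult_def khatri_rao_nth power2_eq_square
        sum.cartesian_product case_prod_beta mult_ac)
  then show ?thesis
    by (simp add: cp_obj_def)
qed

lemma cp_obj_nonneg: "0 \<le> cp_obj T A B C"
  by (simp add: cp_obj_khatri_rao sum_nonneg)

lemma cp_red_le: "cp_red T B C \<le> cp_obj T A B C"
  using cp_opt_A_minimizer[of T B C] by (simp add: cp_red_def is_minimizer_iff)

lemma bdd_below_cp_obj: "bdd_below (range (\<lambda>(A, B, C). cp_obj T A B C))"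
  by (rule bdd_belowI[of _ 0]) (auto simp: cp_obj_nonneg)

lemma bdd_below_cp_red: "bdd_below (range (\<lambda>(B, C). cp_red T B C))"
  by (rule bdd_belowI[of _ 0]) (auto simp: cp_red_def cp_obj_nonneg)

lemma INF_cp_obj_eq_INF_cp_red:
  fixes T :: "real^'k^'j^'i"
  shows "(INF (A :: real^'r^'i, B, C). cp_obj T A B C) =
    (INF (B :: real^'r^'j, C :: real^'r^'k). cp_red T B C)"
proof (rule antisym)
  show "(INF (A :: real^'r^'i, B, C). cp_obj T A B C) \<le>
    (INF (B :: real^'r^'j, C :: real^'r^'k). cp_red T B C)"
  proof (rule cINF_greatest, simp, clarify)
    fix B :: "real^'r^'j" and C :: "real^'r^'k"
    show "(INF (A :: real^'r^'i, B, C). cp_obj T A B C) \<le> cp_red T B C"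
      using cINF_lower[OF bdd_below_cp_obj, of "(cp_opt_A T B C, B, C)" T] by (simp add: cp_red_def)
  qed
  show "(INF (B :: real^'r^'j, C :: real^'r^'k). cp_red T B C) \<le>
    (INF (A :: real^'r^'i, B, C). cp_obj T A B C)"
  proof (rule cINF_greatest, simp, clarify)
    fix A and B :: "real^'r^'j" and C :: "real^'r^'k"
    show "(INF (B :: real^'r^'j, C :: real^'r^'k). cp_red T B C) \<le> cp_obj T A B C"
      using cINF_lower[OF bdd_below_cp_red, of "(B, C)" T] cp_red_le[of T B C A] by simp
  qed
qed

lemma minimizing_seq_cp_objI:
  assumes "minimizing_seq (\<lambda>(B, C). cp_red T B C) (\<lambda>n. (B n, C n))"
    and "\<And>n. is_minimizer (\<lambda>A. cp_obj T A (B n) (C n)) (A n)"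
  shows "minimizing_seq (\<lambda>(A, B, C). cp_obj T A B C) (\<lambda>n. (A n, B n, C n))"
  using assms(1)
  by (simp add: minimizing_seq_def INF_cp_obj_eq_INF_cp_red cp_red_eq[OF assms(2)])

section \<open>Normalization\<close>

text \<open>Column scalings of \<open>B\<close> and \<open>C\<close> can be absorbed into \<open>A\<close>. The scaling factors may
  vanish, so that zero columns need no separate treatment.\<close>

lemma cp_red_le_of_scaled_columns:
  assumes "\<And>j k r. B $ j $ r * C $ k $ r = s r * (B' $ j $ r * C' $ k $ r)"
  shows "cp_red T B' C' \<le> cp_red T B C"
proof -
  let ?A = "cp_opt_A T B C"
  have scale: "a * B $ j $ r * C $ k $ r = s r * a * B' $ j $ r * C' $ k $ r" for a j k r
    using assms[of j r k] by (simp add: mult_ac)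
  have "cp_obj T (\<chi> i r. s r * ?A $ i $ r) B' C' = cp_obj T ?A B C"
    by (simp only: cp_obj_def vec_lambda_beta scale)
  then show ?thesis
    using cp_red_le[of T B' C' "\<chi> i r. s r * ?A $ i $ r"] by (simp add: cp_red_def)
qed

lemma norm_column_times_normalize_columns:
  "norm (column r M) * normalize_columns M $ m $ r = M $ m $ r"
proof (cases "column r M = 0")
  case True
  then have "column r M $ m = 0" by simp
  then have "M $ m $ r = 0" by (simp add: column_def)
  then show ?thesis by (simp add: normalize_columns_def)
qed (simp add: normalize_columns_def)

lemma cp_red_sgn_le: "cp_red T (sgn B) (sgn C) \<le> cp_red T B C"
proof (rule cp_red_le_of_scaled_columns[where s = "\<lambda>_. norm B * norm C"])
  have "X = norm X *\<^sub>R sgn X" for X :: "real^'x^'y"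
    by (cases "X = 0") (simp_all add: sgn_div_norm)
  then have *: "X $ i $ r = norm X * sgn X $ i $ r" for X :: "real^'x^'y" and i r
    by (metis vector_scaleR_component real_scaleR_def)
  show "B $ j $ r * C $ k $ r = norm B * norm C * (sgn B $ j $ r * sgn C $ k $ r)" for j k r
    by (subst *[of B], subst *[of C]) (simp add: mult_ac)
qed

lemma cp_red_normalize_columns_le:
  "cp_red T (normalize_columns B) (normalize_columns C) \<le> cp_red T B C"
proof (rule cp_red_le_of_scaled_columns[where s = "\<lambda>r. norm (column r B) * norm (column r C)"])
  show "B $ j $ r * C $ k $ r = norm (column r B) * norm (column r C) *
      (normalize_columns B $ j $ r * normalize_columns C $ k $ r)" for j k r
    using norm_column_times_normalize_columns[of r B j]
      norm_column_times_normalize_columns[of r C k] by (metis mult.assoc mult.left_commute)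
qed

lemma bounded_sgn_seq: "bounded (range (\<lambda>n :: nat. sgn (X n :: 'a :: real_normed_vector)))"
  by (rule boundedI[of _ 1]) (auto simp: norm_sgn)

lemma bounded_normalize_columns_seq:
  fixes X :: "nat \<Rightarrow> real^'r^'m"
  shows "bounded (range (\<lambda>n. normalize_columns (X n)))"
proof (rule boundedI)
  fix Y :: "real^'r^'m"
  assume "Y \<in> range (\<lambda>n. normalize_columns (X n))"
  then obtain n where n: "Y = normalize_columns (X n)" by blast
  have "norm (Y $ m $ r) \<le> 1" for m r
    using component_le_norm_cart[of "column r (X n)" m]
    by (simp add: n normalize_columns_def column_def divide_le_eq)
  then show "norm Y \<le> norm ((\<chi> m r. 1) :: real^'r^'m)"
    by (intro norm_le_componentwise_cart) simp
qed

lemma bounded_minimizing_seq_subseq: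
  fixes B B' :: "nat \<Rightarrow> real^'r^'j" and C C' :: "nat \<Rightarrow> real^'r^'k"
  assumes min: "minimizing_seq (\<lambda>(B, C). cp_red T B C) (\<lambda>n. (B n, C n))"
    and le: "\<And>n. cp_red T (B' n) (C' n) \<le> cp_red T (B n) (C n)"
    and bdd: "bounded (range B')" "bounded (range C')"
  shows "\<exists>\<phi> Bt Ct. strict_mono \<phi> \<and> (\<lambda>n. B' (\<phi> n)) \<longlonglongrightarrow> Bt \<and> (\<lambda>n. C' (\<phi> n)) \<longlonglongrightarrow> Ct \<and>
     minimizing_seq (\<lambda>(B, C). cp_red T B C) (\<lambda>n. (B' (\<phi> n), C' (\<phi> n)))"
proof -
  have "bounded (range (\<lambda>n. (B' n, C' n)))"
    by (rule bounded_subset[OF bounded_Times[OF bdd]]) auto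
  then obtain l \<phi> where \<phi>: "strict_mono \<phi>" and l: "((\<lambda>n. (B' n, C' n)) \<circ> \<phi>) \<longlonglongrightarrow> l"
    using bounded_imp_convergent_subsequence by blast
  have "minimizing_seq (\<lambda>(B, C). cp_red T B C) (\<lambda>n. (B' n, C' n))"
    by (rule minimizing_seq_dominated[OF min bdd_below_cp_red]) (simp add: le)
  from minimizing_seq_subseq[OF this \<phi>] show ?thesis
    using \<phi> tendsto_fst[OF l] tendsto_snd[OF l] by (auto simp: comp_def)
qed

section \<open>Lower semicontinuity under the rank condition\<close>

lemma cp_red_optimum_with_rows_in:
  assumes "(*v) (khatri_rao B C) ` V = range ((*v) (khatri_rao B C))"
  obtains A where "cp_obj T A B C = cp_red T B C" "\<And>i. A $ i \<in> V"
proof -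
  let ?M = "khatri_rao B C" and ?A = "cp_opt_A T B C"
  have "\<exists>a\<in>V. ?M *v a = ?M *v ?A $ i" for i
    using assms by (metis (no_types, lifting) imageE rangeI)
  then obtain a where a: "\<And>i. a i \<in> V" "\<And>i. ?M *v a i = ?M *v ?A $ i"
    by metis
  have "cp_obj T (\<chi> i. a i) B C = cp_red T B C"
    by (simp add: cp_red_def cp_obj_khatri_rao a)
  with a show thesis
    by (intro that[of "\<chi> i. a i"]) auto
qed

text \<open>An optimal \<open>A\<close> does at least as well as \<open>0\<close>, so its residual is at most the norm of the
  tensor; the bound is independent of \<open>B\<close> and \<open>C\<close>.\<close>

lemma norm_khatri_rao_optimal_row_le:
  assumes "cp_obj T A B C = cp_red T B C"
  shows "norm (khatri_rao B C *v A $ i) \<le> 2 * L2_set (\<lambda>i. norm (tensor_slice T i)) UNIV"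
proof -
  let ?M = "khatri_rao B C" and ?t = "tensor_slice T" and ?S = "L2_set (\<lambda>i. norm (tensor_slice T i)) UNIV"
  have "(norm (?t i - ?M *v A $ i))\<^sup>2 \<le> (\<Sum>i\<in>UNIV. (norm (?t i - ?M *v A $ i))\<^sup>2)"
    by (intro member_le_sum) auto
  also have "\<dots> \<le> (\<Sum>i\<in>UNIV. (norm (?t i))\<^sup>2)"
    using cp_red_le[of T B C 0] assms by (simp add: cp_obj_khatri_rao)
  also have "\<dots> = ?S\<^sup>2"
    by (simp add: L2_set_def sum_nonneg)
  finally have "norm (?t i - ?M *v A $ i) \<le> ?S"
    by (rule power2_le_imp_le) (rule L2_set_nonneg)
  moreover have "norm (?t i) \<le> ?S"
    by (rule member_le_L2_set) auto
  ultimately show ?thesis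
    using norm_triangle_ineq2[of "?M *v A $ i" "?t i"] by (simp add: norm_minus_commute)
qed

lemma tendsto_khatri_rao:
  assumes "B \<longlonglongrightarrow> Bt" "C \<longlonglongrightarrow> Ct"
  shows "(\<lambda>n. khatri_rao (B n) (C n)) \<longlonglongrightarrow> khatri_rao Bt Ct"
  unfolding khatri_rao_def kronecker_vec_def column_def
  by (intro tendsto_intros assms)

lemma tendsto_cp_obj:
  assumes "A \<longlonglongrightarrow> At" "B \<longlonglongrightarrow> Bt" "C \<longlonglongrightarrow> Ct"
  shows "(\<lambda>n. cp_obj T (A n) (B n) (C n)) \<longlonglongrightarrow> cp_obj T At Bt Ct"
  unfolding cp_obj_def by (intro tendsto_intros assms)

lemma cp_red_limit_le:
  fixes T :: "real^'k^'j^'i" and Bt :: "real^'r^'j" and Ct :: "real^'r^'k"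
  assumes lim: "B \<longlonglongrightarrow> Bt" "C \<longlonglongrightarrow> Ct" "(\<lambda>n. cp_red T (B n) (C n)) \<longlonglongrightarrow> l"
    and rank: "\<And>n. rank (khatri_rao (B n) (C n)) \<le> rank (khatri_rao Bt Ct)"
  shows "cp_red T Bt Ct \<le> l"
proof -
  let ?M = "\<lambda>n. khatri_rao (B n) (C n)" and ?V = "span (rows (khatri_rao Bt Ct))"
  obtain c where "c > 0"
    and "\<forall>\<^sub>F n in sequentially. \<forall>x\<in>?V. c * norm x \<le> norm (?M n *v x)"
    using rowspace_bounded_below[OF tendsto_khatri_rao[OF lim(1,2)]] .
  then obtain N where N: "\<And>n x. N \<le> n \<Longrightarrow> x \<in> ?V \<Longrightarrow> c * norm x \<le> norm (?M n *v x)"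
    unfolding eventually_sequentially by blast
  \<comment> \<open>From index \<open>N\<close> on, optimal \<open>A\<close> can be chosen with all rows in the fixed subspace, where
    the lower bound makes them bounded uniformly in \<open>n\<close>.\<close>
  have "\<exists>A. cp_obj T A (B (n + N)) (C (n + N)) = cp_red T (B (n + N)) (C (n + N)) \<and>
      (\<forall>i. A $ i \<in> ?V)" for n
  proof -
    have "(*v) (?M (n + N)) ` ?V = range ((*v) (?M (n + N)))"
    proof (rule image_rowspace_eq_range[OF rank])
      fix x assume "x \<in> ?V" "?M (n + N) *v x = 0"
      with N[of "n + N" x] have "c * norm x \<le> 0" by simp
      with \<open>c > 0\<close> show "x = 0" by (simp add: mult_le_0_iff)
    qed
    then show ?thesis
      using cp_red_optimum_with_rows_in by metis
  qed
  then obtain A where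
    A: "\<And>n. cp_obj T (A n) (B (n + N)) (C (n + N)) = cp_red T (B (n + N)) (C (n + N))"
    and V: "\<And>n i. A n $ i \<in> ?V"
    by metis
  define b where "b = 2 * L2_set (\<lambda>i. norm (tensor_slice T i)) UNIV / c"
  have "norm (A n $ i) \<le> b" for n i
  proof -
    have "c * norm (A n $ i) \<le> norm (?M (n + N) *v A n $ i)"
      by (rule N) (simp_all add: V)
    also have "\<dots> \<le> 2 * L2_set (\<lambda>i. norm (tensor_slice T i)) UNIV"
      by (rule norm_khatri_rao_optimal_row_le[OF A])
    finally show ?thesis
      using \<open>c > 0\<close> by (simp add: b_def field_simps)
  qed
  then have "norm (A n) \<le> (\<Sum>i\<in>(UNIV :: 'i set). b)" for n
    unfolding norm_vec_def[of "A n"] by (intro order_trans[OF L2_set_le_sum] sum_mono) auto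
  then have "bounded (range A)"
    by (intro boundedI) auto
  then obtain At \<phi> where "strict_mono \<phi>" and At: "(A \<circ> \<phi>) \<longlonglongrightarrow> At"
    using bounded_imp_convergent_subsequence by blast
  then have \<psi>: "filterlim (\<lambda>n. \<phi> n + N) sequentially sequentially"
    by (intro filterlim_compose[OF filterlim_add_const_nat_at_top] filterlim_subseq)
  have "(\<lambda>n. cp_obj T (A (\<phi> n)) (B (\<phi> n + N)) (C (\<phi> n + N))) \<longlonglongrightarrow> cp_obj T At Bt Ct"
    using At lim(1,2)[THEN filterlim_compose, OF \<psi>] by (intro tendsto_cp_obj) (simp_all add: comp_def)
  moreover have "(\<lambda>n. cp_obj T (A (\<phi> n)) (B (\<phi> n + N)) (C (\<phi> n + N))) \<longlonglongrightarrow> l"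
    unfolding A using lim(3)[THEN filterlim_compose, OF \<psi>] .
  ultimately have "cp_obj T At Bt Ct = l"
    by (rule LIMSEQ_unique)
  then show ?thesis
    using cp_red_le[of T Bt Ct At] by simp
qed

lemma is_minimizer_cp_red_limit:
  fixes Bt :: "real^'r^'j" and Ct :: "real^'r^'k"
  assumes min: "minimizing_seq (\<lambda>(B, C). cp_red T B C) (\<lambda>n. (B n, C n))"
    and lim: "B \<longlonglongrightarrow> Bt" "C \<longlonglongrightarrow> Ct"
    and rank: "liminf (\<lambda>n. enat (rank (khatri_rao (B n) (C n)))) \<le> enat (rank (khatri_rao Bt Ct))"
  shows "is_minimizer (\<lambda>(B, C). cp_red T B C) (Bt, Ct)"
proof -
  obtain \<phi> :: "nat \<Rightarrow> nat" where \<phi>: "strict_mono \<phi>"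
    and le: "\<And>n. rank (khatri_rao (B (\<phi> n)) (C (\<phi> n))) \<le> rank (khatri_rao Bt Ct)"
    by (rule liminf_enat_le_imp_subseq[OF rank]) (rule that)
  have "(\<lambda>n. cp_red T (B (\<phi> n)) (C (\<phi> n))) \<longlonglongrightarrow>
      (INF (B :: real^'r^'j, C :: real^'r^'k). cp_red T B C)"
    using minimizing_seq_subseq[OF min \<phi>] by (simp add: minimizing_seq_def)
  then have "cp_red T Bt Ct \<le> (INF (B :: real^'r^'j, C :: real^'r^'k). cp_red T B C)"
    using cp_red_limit_le[OF lim[THEN LIMSEQ_subseq_LIMSEQ, OF \<phi>]] le by (simp add: comp_def)
  also have "\<dots> \<le> cp_red T B' C'" for B' C' :: "real^'r^_"
    using cINF_lower[OF bdd_below_cp_red, of "(B', C')" T] by simp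
  finally show ?thesis
    by (simp add: is_minimizer_iff)
qed

lemma is_minimizer_cp_objI:
  fixes B :: "real^'r^'j" and C :: "real^'r^'k"
  assumes "is_minimizer (\<lambda>(B, C). cp_red T B C) (B, C)" "is_minimizer (\<lambda>A. cp_obj T A B C) A"
  shows "is_minimizer (\<lambda>(A, B, C). cp_obj T A B C) (A, B, C)"
proof -
  have "cp_obj T A B C \<le> cp_obj T A' B' C'" for A' and B' C' :: "real^'r^_"
  proof -
    have "cp_obj T A B C = cp_red T B C"
      by (rule cp_red_eq[OF assms(2), symmetric])
    also have "\<dots> \<le> cp_red T B' C'"
      using assms(1) by (simp add: is_minimizer_iff)
    also have "\<dots> \<le> cp_obj T A' B' C'"
      by (rule cp_red_le)
    finally show ?thesis .
  qed
  then show ?thesis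
    by (simp add: is_minimizer_iff)
qed

theorem proposition3p7:
  fixes T :: "real^'k^'j^'i"
    and B :: "nat \<Rightarrow> real^'r^'j"
    and C :: "nat \<Rightarrow> real^'r^'k"
  assumes "minimizing_seq (\<lambda>(B, C). cp_red T B C) (\<lambda>n. (B n, C n))"
  shows
    "(minimizing_seq (\<lambda>(A, B, C). cp_obj T A B C) (\<lambda>n. (cp_opt_A T (B n) (C n), B n, C n)) \<and>
      (\<forall>A. (\<forall>n. is_minimizer (\<lambda>A. cp_obj T A (B n) (C n)) (A n)) \<longrightarrow>
        minimizing_seq (\<lambda>(A, B, C). cp_obj T A B C) (\<lambda>n. (A n, B n, C n))))
     \<and>
     (\<exists>\<phi> Bt Ct. strict_mono \<phi> \<and>
        (\<lambda>n. sgn (B (\<phi> n))) \<longlonglongrightarrow> Bt \<and> (\<lambda>n. sgn (C (\<phi> n))) \<longlonglongrightarrow> Ct \<and>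
        minimizing_seq (\<lambda>(B, C). cp_red T B C) (\<lambda>n. (sgn (B (\<phi> n)), sgn (C (\<phi> n)))))
     \<and>
     (\<exists>\<phi> Bt Ct. strict_mono \<phi> \<and>
        (\<lambda>n. normalize_columns (B (\<phi> n))) \<longlonglongrightarrow> Bt \<and>
        (\<lambda>n. normalize_columns (C (\<phi> n))) \<longlonglongrightarrow> Ct \<and>
        minimizing_seq (\<lambda>(B, C). cp_red T B C)
          (\<lambda>n. (normalize_columns (B (\<phi> n)), normalize_columns (C (\<phi> n)))))
     \<and>
     (\<forall>Bt Ct. B \<longlonglongrightarrow> Bt \<and> C \<longlonglongrightarrow> Ct \<and>
        liminf (\<lambda>n. enat (rank (khatri_rao (B n) (C n)))) \<le> enat (rank (khatri_rao Bt Ct)) \<longrightarrow>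
        is_minimizer (\<lambda>(B, C). cp_red T B C) (Bt, Ct) \<and>
        is_minimizer (\<lambda>(A, B, C). cp_obj T A B C) (cp_opt_A T Bt Ct, Bt, Ct) \<and>
        (\<forall>A. is_minimizer (\<lambda>A. cp_obj T A Bt Ct) A \<longrightarrow>
          is_minimizer (\<lambda>(A, B, C). cp_obj T A B C) (A, Bt, Ct)) \<and>
        (\<exists>(A :: real^'r^'i) (B :: real^'r^'j) (C :: real^'r^'k).
          is_minimizer (\<lambda>(A, B, C). cp_obj T A B C) (A, B, C)))"
proof -
  let ?f = "\<lambda>(A, B, C). cp_obj T A B C"
  have obj: "minimizing_seq ?f (\<lambda>n. (A n, B n, C n))"
    if "\<forall>n. is_minimizer (\<lambda>A. cp_obj T A (B n) (C n)) (A n)" for A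
    using minimizing_seq_cp_objI[OF assms] that by blast
  have limit: "is_minimizer (\<lambda>(B, C). cp_red T B C) (Bt, Ct) \<and>
      is_minimizer ?f (cp_opt_A T Bt Ct, Bt, Ct) \<and>
      (\<forall>A. is_minimizer (\<lambda>A. cp_obj T A Bt Ct) A \<longrightarrow> is_minimizer ?f (A, Bt, Ct)) \<and>
      (\<exists>(A :: real^'r^'i) (B :: real^'r^'j) (C :: real^'r^'k). is_minimizer ?f (A, B, C))"
    if "B \<longlonglongrightarrow> Bt \<and> C \<longlonglongrightarrow> Ct \<and>
      liminf (\<lambda>n. enat (rank (khatri_rao (B n) (C n)))) \<le> enat (rank (khatri_rao Bt Ct))" for Bt Ct
  proof -
    have red: "is_minimizer (\<lambda>(B, C). cp_red T B C) (Bt, Ct)"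
      using is_minimizer_cp_red_limit[OF assms] that by blast
    from is_minimizer_cp_objI[OF red] cp_opt_A_minimizer[of T Bt Ct] red show ?thesis
      by blast
  qed
  have opt: "minimizing_seq ?f (\<lambda>n. (cp_opt_A T (B n) (C n), B n, C n))"
    by (intro obj allI cp_opt_A_minimizer)
  note sgn = bounded_minimizing_seq_subseq[OF assms cp_red_sgn_le bounded_sgn_seq bounded_sgn_seq]
  note normalized = bounded_minimizing_seq_subseq[OF assms cp_red_normalize_columns_le
      bounded_normalize_columns_seq bounded_normalize_columns_seq]
  show ?thesis
    by (rule conjI[OF conjI[OF opt] conjI[OF sgn conjI[OF normalized]]])
      (intro allI impI, erule obj, intro allI impI, erule limit)
qed

end
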